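(* Let $(Y_t,Z_t,K_t)_{0\le t\le T}$ be a solution of the reflected backward stochastic difference equation (RBSDE) with standard data $(\xi,f,S)$. Then for each $t\in\{0,1,\dots,T\}$, $P$-a.s., $$K_T-K_t=\sup_{t\le u\le T}\Big(\xi+\sum_{u\le s<T}f(s,Y_s,Z_s)-\sum_{u\le s<T}Z_s^{*}M_{s+1}-S_u\Big)^{-}.$$
   Context: Setting: $T$ is a positive integer, $m\ge 1$, and $X=(X_t)_{0\le t\le T}$ is a stochastic process with values in the set of standard basis vectors $\{e_1,\dots,e_m\}$ of $\mathbb{R}^m$ on a probability space $(\Omega,\mathcal{F},P)$; $\mathcal{F}_t$ is the completion of $\sigma(X_0,\dots,X_t)$ and $\mathcal{F}=\mathcal{F}_T$. $M_t=X_t-E[X_t\mid\mathcal{F}_{t-1}]$ for $t=1,\dots,T$. $[\cdot]^*$ denotes transposition and $x^-=\max(-x,0)$. Standard data: a triple $(\xi,f,S)$ where $\xi\in L^1(\mathcal{F}_T;\mathbb{R})$; $f:\Omega\times\{0,\dots,T\}\times\mathbb{R}\times\mathbb{R}^m\to\mathbb{R}$ is such that $f(\cdot,y,z)$ is an adapted process for every $(y,z)$; and $S=(S_t)_{0\le t\le T}$ (the obstacle) is a real-valued adapted process with $S_T\le\xi$ $P$-a.s. Solution of the RBSDE with data $(\xi,f,S)$: adapted processes $(Y_t,Z_t,K_t)_{0\le t\le T}$ with values in $\mathbb{R}\times\mathbb{R}^m\times\mathbb{R}$ such that for all $0\le t\le T$: (i) $Y_t=\xi+\sum_{t\le u<T}f(u,Y_u,Z_u)+K_T-K_t-\sum_{t\le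 u<T}Z_u^*M_{u+1}$ $P$-a.s.; (ii) $Y_t,Z_t,K_t$ are integrable; (iii) $Y_t\ge S_t$ $P$-a.s.; (iv) $K$ is increasing (non-decreasing) in $t$, $K_0=0$, and $\sum_{0\le t<T}(Y_t-S_t)(K_{t+1}-K_t)=0$ $P$-a.s. *)

theory Defs
  imports "HOL-Probability.Probability"
begin

text \<open>
  Processes are written \<open>Y t \<omega>\<close>; only the times \<open>t \<le> T\<close> are ever constrained.
  The space \<open>\<real>\<^sup>m\<close> is \<open>real ^ 'm\<close>, so \<open>m \<ge> 1\<close> holds because types are nonempty.
\<close>

definition generated_sigma :: "'a measure \<Rightarrow> (nat \<Rightarrow> 'a \<Rightarrow> real ^ 'm) \<Rightarrow> nat \<Rightarrow> 'a measure" where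
  "generated_sigma P X t =
     sigma (space P) (\<Union>s\<in>{..t}. sets (vimage_algebra (space P) (X s) borel))"

text \<open>
  The completed filtration: \<open>\<sigma>(X\<^sub>0, \<dots>, X\<^sub>t)\<close> is enlarged by all \<open>P\<close>-null sets of the full
  \<open>\<sigma>\<close>-algebra, as is usual for filtrations. This contains the completion of
  \<open>\<sigma>(X\<^sub>0, \<dots>, X\<^sub>t)\<close> as a measure space in its own right, so adaptedness is the weaker of the two
  possible requirements; conditional expectations for the two agree almost surely.
\<close>

definition filt :: "'a measure \<Rightarrow> (nat \<Rightarrow> 'a \<Rightarrow> real ^ 'm) \<Rightarrow> nat \<Rightarrow> 'a measure" where
  "filt P X t = sigma (space P) (sets (generated_sigma P X t) \<union> null_sets P)"

definition adapted ::
  "'a measure \<Rightarrow> (nat \<Rightarrow> 'a \<Rightarrow> real ^ 'm) \<Rightarrow> nat \<Rightarrow> (nat \<Rightarrow> 'a \<Rightarrow> 'b::topological_space) \<Rightarrow> bool" where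
  "adapted P X T Y \<longleftrightarrow> (\<forall>t\<le>T. Y t \<in> borel_measurable (filt P X t))"

text \<open>
  The last conjunct says that \<open>\<F>\<close>, the \<open>\<sigma>\<close>-algebra of \<open>P\<close>, is the completion of
  \<open>\<sigma>(X\<^sub>0, \<dots>, X\<^sub>T)\<close>. It is expressed with \<^const>\<open>completion\<close> rather than
  \<^const>\<open>filt\<close> because \<open>filt P X T\<close> refers to the null sets of \<open>\<F>\<close> itself, so that equating
  it with \<open>\<F>\<close> would not determine \<open>\<F>\<close>.
\<close>

definition basis_process :: "'a measure \<Rightarrow> nat \<Rightarrow> (nat \<Rightarrow> 'a \<Rightarrow> real ^ 'm) \<Rightarrow> bool" where
  "basis_process P T X \<longleftrightarrow>
     prob_space P \<and>
     (\<forall>t\<le>T. X t \<in> borel_measurable P) \<and>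
     (\<forall>t\<le>T. \<forall>\<omega>\<in>space P. X t \<omega> \<in> range (\<lambda>i. axis i 1)) \<and>
     sets P = sets (completion (restr_to_subalg P (generated_sigma P X T)))"

text \<open>
  The conditional expectation of a vector is taken componentwise, the library operator being
  real-valued. Only the values at \<open>t \<ge> 1\<close> are meaningful.
\<close>

definition mart_diff ::
  "'a measure \<Rightarrow> (nat \<Rightarrow> 'a \<Rightarrow> real ^ 'm) \<Rightarrow> nat \<Rightarrow> 'a \<Rightarrow> real ^ 'm" where
  "mart_diff P X t \<omega> =
     X t \<omega> - (\<chi> i. real_cond_exp P (filt P X (t - 1)) (\<lambda>\<omega>'. X t \<omega>' $ i) \<omega>)"

definition neg_part :: "real \<Rightarrow> real" where
  "neg_part x = max (- x) 0"

definition standard_data ::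
  "'a measure \<Rightarrow> nat \<Rightarrow> (nat \<Rightarrow> 'a \<Rightarrow> real ^ 'm) \<Rightarrow>
   ('a \<Rightarrow> real) \<Rightarrow> ('a \<Rightarrow> nat \<Rightarrow> real \<Rightarrow> real ^ 'm \<Rightarrow> real) \<Rightarrow> (nat \<Rightarrow> 'a \<Rightarrow> real) \<Rightarrow> bool" where
  "standard_data P T X \<xi> f S \<longleftrightarrow>
     \<xi> \<in> borel_measurable (filt P X T) \<and> integrable P \<xi> \<and>
     (\<forall>y z. adapted P X T (\<lambda>t \<omega>. f \<omega> t y z)) \<and>
     adapted P X T S \<and>
     (AE \<omega> in P. S T \<omega> \<le> \<xi> \<omega>)"

definition rbsde_solution ::
  "'a measure \<Rightarrow> nat \<Rightarrow> (nat \<Rightarrow> 'a \<Rightarrow> real ^ 'm) \<Rightarrow>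
   ('a \<Rightarrow> real) \<Rightarrow> ('a \<Rightarrow> nat \<Rightarrow> real \<Rightarrow> real ^ 'm \<Rightarrow> real) \<Rightarrow> (nat \<Rightarrow> 'a \<Rightarrow> real) \<Rightarrow>
   (nat \<Rightarrow> 'a \<Rightarrow> real) \<Rightarrow> (nat \<Rightarrow> 'a \<Rightarrow> real ^ 'm) \<Rightarrow> (nat \<Rightarrow> 'a \<Rightarrow> real) \<Rightarrow> bool" where
  "rbsde_solution P T X \<xi> f S Y Z K \<longleftrightarrow>
     adapted P X T Y \<and> adapted P X T Z \<and> adapted P X T K \<and>
     (\<forall>t\<le>T. AE \<omega> in P.
        Y t \<omega> = \<xi> \<omega> + (\<Sum>u\<in>{t..<T}. f \<omega> u (Y u \<omega>) (Z u \<omega>)) + K T \<omega> - K t \<omega>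
                 - (\<Sum>u\<in>{t..<T}. Z u \<omega> \<bullet> mart_diff P X (u + 1) \<omega>)) \<and>
     (\<forall>t\<le>T. integrable P (Y t) \<and> integrable P (Z t) \<and> integrable P (K t)) \<and>
     (\<forall>t\<le>T. AE \<omega> in P. S t \<omega> \<le> Y t \<omega>) \<and>
     (AE \<omega> in P. \<forall>t<T. K t \<omega> \<le> K (t + 1) \<omega>) \<and>
     (AE \<omega> in P. K 0 \<omega> = 0) \<and>
     (AE \<omega> in P. (\<Sum>t\<in>{0..<T}. (Y t \<omega> - S t \<omega>) * (K (t + 1) \<omega> - K t \<omega>)) = 0)"

end

theory Submission
  imports Defs
begin

text \<open>
  By the equation for \<open>Y\<close>, the expression under the negative part at time \<open>u\<close> is
  \<open>(Y\<^sub>u - S\<^sub>u) - (K\<^sub>T - K\<^sub>u)\<close>, so the claim is pathwise. Since \<open>Y \<ge> S\<close> and \<open>K\<close> is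
  non-decreasing, each term of the supremum is at most \<open>K\<^sub>T - K\<^sub>t\<close>. The bound is attained at the
  last time \<open>u\<close> with \<open>K\<^sub>u = K\<^sub>t\<close>: either \<open>u = T\<close>, or \<open>K\<close> increases right after \<open>u\<close>, and then
  the flat-off condition gives \<open>Y\<^sub>u = S\<^sub>u\<close>.
\<close>

lemma mono_upto:
  fixes k :: "nat \<Rightarrow> 'a::preorder"
  assumes "\<forall>n<T. k n \<le> k (n + 1)" "i \<le> j" "j \<le> T"
  shows "k i \<le> k j"
  using assms(2,3)
proof (induction j rule: dec_induct)
  case (step n)
  then show ?case using assms(1) by (auto intro: order_trans)
qed simp

text \<open>Deterministic core, to be applied along almost every path with \<open>d = Y - S\<close>
  and \<open>k = K\<close>.\<close>

lemma flat_off_SUP_neg_part: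
  fixes d k :: "nat \<Rightarrow> real"
  assumes "t \<le> T"
    and d: "\<forall>u\<le>T. 0 \<le> d u"
    and k: "\<forall>u<T. k u \<le> k (u + 1)"
    and flat: "(\<Sum>u\<in>{0..<T}. d u * (k (u + 1) - k u)) = 0"
  shows "(SUP u\<in>{t..T}. neg_part (d u - (k T - k u))) = k T - k t"
proof (rule cSup_eq_maximum)
  define u where "u = Max {u \<in> {t..T}. k u = k t}"
  have "u \<in> {u \<in> {t..T}. k u = k t}"
    unfolding u_def using \<open>t \<le> T\<close> by (intro Max_in) auto
  then have u: "t \<le> u" "u \<le> T" "k u = k t" by auto
  have "d u = 0" if "u < T"
  proof -
    have "k (u + 1) \<noteq> k t"
    proof
      assume "k (u + 1) = k t"
      then have "u + 1 \<in> {u \<in> {t..T}. k u = k t}"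
        using u that by simp
      then have "u + 1 \<le> u"
        by (subst (2) u_def, intro Max_ge) auto
      then show False by simp
    qed
    \<comment> \<open>A vanishing sum of nonnegative terms vanishes termwise; at
      \<open>v = u\<close> the increment of \<open>k\<close> is nonzero, which leaves
      \<open>d u = 0\<close>.\<close>
    moreover have "\<forall>v\<in>{0..<T}. d v * (k (v + 1) - k v) = 0"
      using flat d k by (subst (asm) sum_nonneg_eq_0_iff) auto
    ultimately show ?thesis using u that by auto
  qed
  moreover have "k t \<le> k T" using mono_upto[OF k] \<open>t \<le> T\<close> by simp
  \<comment> \<open>If \<open>u = T\<close>, both sides are 0, since \<open>d T\<close> is
    nonnegative and \<open>k T = k t\<close>. Otherwise \<open>d u = 0\<close>, and
    \<open>k t \<le> k T\<close> makes the negative part equal to \<open>k T - k t\<close>.\<close>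
  ultimately have "neg_part (d u - (k T - k u)) = k T - k t"
    using u d by (cases "u = T") (auto simp: neg_part_def)
  then show "k T - k t \<in> (\<lambda>u. neg_part (d u - (k T - k u))) ` {t..T}"
    using u by (intro image_eqI[of _ _ u]) auto
next
  fix x assume "x \<in> (\<lambda>u. neg_part (d u - (k T - k u))) ` {t..T}"
  then obtain u where u: "t \<le> u" "u \<le> T" and x: "x = neg_part (d u - (k T - k u))"
    by auto
  \<comment> \<open>The first and third facts bound the argument \<open>- x\<close> of the maximum
    in \<open>neg_part\<close>, the second bounds its other argument 0.\<close>
  have "k t \<le> k u" "k t \<le> k T" "0 \<le> d u" using mono_upto[OF k] u d by auto
  then show "x \<le> k T - k t" unfolding x neg_part_def by auto
qed

theorem proposition2p7:
  fixes P :: "'a measure"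
    and X :: "nat \<Rightarrow> 'a \<Rightarrow> real ^ 'm"
    and T :: nat
    and \<xi> :: "'a \<Rightarrow> real"
    and f :: "'a \<Rightarrow> nat \<Rightarrow> real \<Rightarrow> real ^ 'm \<Rightarrow> real"
    and S Y K :: "nat \<Rightarrow> 'a \<Rightarrow> real"
    and Z :: "nat \<Rightarrow> 'a \<Rightarrow> real ^ 'm"
  assumes "0 < T"
    and "basis_process P T X"
    and "standard_data P T X \<xi> f S"
    and "rbsde_solution P T X \<xi> f S Y Z K"
  shows "\<forall>t\<in>{0..T}. AE \<omega> in P.
    K T \<omega> - K t \<omega> =
      (SUP u\<in>{t..T}. neg_part
         (\<xi> \<omega> + (\<Sum>s\<in>{u..<T}. f \<omega> s (Y s \<omega>) (Z s \<omega>))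
              - (\<Sum>s\<in>{u..<T}. Z s \<omega> \<bullet> mart_diff P X (s + 1) \<omega>) - S u \<omega>))"
proof
  fix t assume "t \<in> {0..T}"
  then have "t \<le> T" by simp
  note sol = assms(4)[unfolded rbsde_solution_def]
  \<comment> \<open>The exceptional null set may depend on the time; as there are finitely many
    times, one null set serves for all \<open>u\<close> in the supremum.\<close>
  have Y: "AE \<omega> in P. \<forall>u\<in>{..T}. Y u \<omega> =
      \<xi> \<omega> + (\<Sum>s\<in>{u..<T}. f \<omega> s (Y s \<omega>) (Z s \<omega>)) + K T \<omega> - K u \<omega>
        - (\<Sum>s\<in>{u..<T}. Z s \<omega> \<bullet> mart_diff P X (s + 1) \<omega>)"
    using sol by (intro AE_finite_allI) auto
  have S: "AE \<omega> in P. \<forall>u\<in>{..T}. S u \<omega> \<le> Y u \<omega>"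
    using sol by (intro AE_finite_allI) auto
  have K: "AE \<omega> in P. \<forall>u<T. K u \<omega> \<le> K (u + 1) \<omega>"
    and flat: "AE \<omega> in P. (\<Sum>u\<in>{0..<T}. (Y u \<omega> - S u \<omega>) * (K (u + 1) \<omega> - K u \<omega>)) = 0"
    using sol by blast+
  show "AE \<omega> in P. K T \<omega> - K t \<omega> =
      (SUP u\<in>{t..T}. neg_part
         (\<xi> \<omega> + (\<Sum>s\<in>{u..<T}. f \<omega> s (Y s \<omega>) (Z s \<omega>))
              - (\<Sum>s\<in>{u..<T}. Z s \<omega> \<bullet> mart_diff P X (s + 1) \<omega>) - S u \<omega>))"
    using Y S K flat
  proof eventually_elim
    case (elim \<omega>)
    have "(SUP u\<in>{t..T}. neg_part
         (\<xi> \<omega> + (\<Sum>s\<in>{u..<T}. f \<omega> s (Y s \<omega>) (Z s \<omega>))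
              - (\<Sum>s\<in>{u..<T}. Z s \<omega> \<bullet> mart_diff P X (s + 1) \<omega>) - S u \<omega>)) =
        (SUP u\<in>{t..T}. neg_part ((Y u \<omega> - S u \<omega>) - (K T \<omega> - K u \<omega>)))"
    proof (intro SUP_cong refl arg_cong[of _ _ neg_part])
      fix u assume "u \<in> {t..T}"
      then show "\<xi> \<omega> + (\<Sum>s\<in>{u..<T}. f \<omega> s (Y s \<omega>) (Z s \<omega>))
          - (\<Sum>s\<in>{u..<T}. Z s \<omega> \<bullet> mart_diff P X (s + 1) \<omega>) - S u \<omega> =
          (Y u \<omega> - S u \<omega>) - (K T \<omega> - K u \<omega>)"
        using bspec[OF elim(1), of u] by simp
    qed
    also have "\<dots> = K T \<omega> - K t \<omega>"
      using \<open>t \<le> T\<close> elim(2-4) by (intro flat_off_SUP_neg_part) auto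
    finally show ?case by simp
  qed
qed

end
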